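(* Suppose the generator is $\Phi(p,\Theta)=p$. Then: (a) for $\alpha>0$ the dynamic-memory fractional integral reduces to the classical Riemann--Liouville fractional integral, $$(\mathcal I_\Phi^\alpha x)(t)=\frac{1}{\Gamma(\alpha)}\int_0^t (t-s)^{\alpha-1}x(s)\,ds;$$ (b) for $0<\alpha<1$ the Riemann--Liouville dynamic-memory fractional derivative reduces to the classical Riemann--Liouville fractional derivative, $$(\mathcal D_\Phi^\alpha x)(t)=\frac{1}{\Gamma(1-\alpha)}\frac{d}{dt}\int_0^t (t-s)^{-\alpha}x(s)\,ds;$$ (c) for $0<\alpha<1$ the Caputo dynamic-memory fractional derivative reduces to the classical Caputo fractional derivative, $$({}^c\mathcal D_\Phi^\alpha x)(t)=\frac{1}{\Gamma(1-\alpha)}\int_0^t (t-s)^{-\alpha}x'(s)\,ds.$$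
   Context: For a positive function $\Phi(p,\Theta)$ of the Laplace variable $p>0$ (and fixed parameters $\Theta$), called a dynamic memory generator, the dynamic-memory kernel of order $\gamma>0$ is $\Psi_\gamma(t;\Theta)=\mathcal L^{-1}\{\Phi(p,\Theta)^{-\gamma}\}(t)$, the function on $(0,\infty)$ with Laplace transform $\Phi(p,\Theta)^{-\gamma}$. For $t\in[0,T]$, the operators are defined by $(\mathcal I_\Phi^\alpha x)(t)=\int_0^t\Psi_\alpha(t-s;\Theta)x(s)\,ds$ for $\alpha>0$; and, for $0<\alpha<1$, $(\mathcal D_\Phi^\alpha x)(t)=\frac{d}{dt}\int_0^t\Psi_{1-\alpha}(t-s;\Theta)x(s)\,ds$ and $({}^c\mathcal D_\Phi^\alpha x)(t)=\int_0^t\Psi_{1-\alpha}(t-s;\Theta)x'(s)\,ds$. Functions $x:[0,T]\to\mathbb R$ are assumed sufficiently smooth so that all the integrals and derivatives involved are well defined. *)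

theory Defs
  imports "HOL-Analysis.Analysis"
begin

definition has_laplace_transform :: "(real \<Rightarrow> real) \<Rightarrow> (real \<Rightarrow> real) \<Rightarrow> bool" where
  "has_laplace_transform f F \<longleftrightarrow>
     (\<forall>p>0. interval_lebesgue_integrable lborel 0 \<infinity> (\<lambda>t. exp (- (p * t)) * f t) \<and>
            (LBINT t=0..\<infinity>. exp (- (p * t)) * f t) = F p)"

text \<open>
  A function on the open half-line is determined by its Laplace transform only up to a
  Lebesgue null set, and the original is chosen arbitrarily among these versions. The operators
  below use it only under an integral sign, so they do not depend on the choice.
  If there is no original, the value is arbitrary.
\<close>

definition inverse_laplace :: "(real \<Rightarrow> real) \<Rightarrow> real \<Rightarrow> real" where
  "inverse_laplace F = (SOME f. has_laplace_transform f F)"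

text \<open>
  A generator is a function of the Laplace variable and of a parameter of arbitrary type.
\<close>

definition dm_kernel :: "(real \<Rightarrow> 'p \<Rightarrow> real) \<Rightarrow> 'p \<Rightarrow> real \<Rightarrow> real \<Rightarrow> real" where
  "dm_kernel \<Phi> \<Theta> \<gamma> = inverse_laplace (\<lambda>p. \<Phi> p \<Theta> powr (- \<gamma>))"

definition dm_integral ::
    "(real \<Rightarrow> 'p \<Rightarrow> real) \<Rightarrow> 'p \<Rightarrow> real \<Rightarrow> (real \<Rightarrow> real) \<Rightarrow> real \<Rightarrow> real" where
  "dm_integral \<Phi> \<Theta> \<alpha> x t = (LBINT s=0..t. dm_kernel \<Phi> \<Theta> \<alpha> (t - s) * x s)"

text \<open>
  Functions live on \<open>[0, T]\<close>, so the outer derivative of the Riemann--Liouville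
  operator is taken relative to that interval (one-sided at the end points).
\<close>

definition dm_rl_derivative ::
    "real \<Rightarrow> (real \<Rightarrow> 'p \<Rightarrow> real) \<Rightarrow> 'p \<Rightarrow> real \<Rightarrow> (real \<Rightarrow> real) \<Rightarrow> real \<Rightarrow> real" where
  "dm_rl_derivative T \<Phi> \<Theta> \<alpha> x t =
     vector_derivative (\<lambda>\<tau>. LBINT s=0..\<tau>. dm_kernel \<Phi> \<Theta> (1 - \<alpha>) (\<tau> - s) * x s)
       (at t within {0..T})"

text \<open>
  The interval integral ranges over the open interval \<open>(0, t)\<close>; hence for \<open>t \<le> T\<close> only
  derivatives of \<open>x\<close> at interior points of \<open>[0, T]\<close> enter.
\<close>

definition dm_caputo_derivative ::
    "(real \<Rightarrow> 'p \<Rightarrow> real) \<Rightarrow> 'p \<Rightarrow> real \<Rightarrow> (real \<Rightarrow> real) \<Rightarrow> real \<Rightarrow> real" where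
  "dm_caputo_derivative \<Phi> \<Theta> \<alpha> x t =
     (LBINT s=0..t. dm_kernel \<Phi> \<Theta> (1 - \<alpha>) (t - s) * deriv x s)"

end

theory Submission
  imports Defs
begin

text \<open>
  For \<open>\<Phi>(p) = p\<close> the kernel of order \<open>\<gamma>\<close> is an inverse Laplace transform of \<open>p\<^sup>-\<^sup>\<gamma>\<close>. Euler's
  integral, rescaled by \<open>p\<close>, shows that \<open>t\<^sup>\<gamma>\<^sup>-\<^sup>1 / \<Gamma>(\<gamma>)\<close> is one original of this function, but the
  kernel is an arbitrarily chosen original. What makes the choice harmless is Lerch's theorem
  (\<open>laplace_transform_unique_AE\<close>): two originals of the same function agree almost everywhere.
  The three operators are convolutions with the kernel, so they only see its class modulo null sets,
  and all three reductions are instances of \<open>convolution_dm_kernel_power\<close>.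

  Lerch's theorem is a moment problem in disguise. If \<open>h\<close> is the difference of the two originals,
  then \<open>H(t) = e\<^sup>-\<^sup>t h(t)\<close> is integrable on the half-line, and the vanishing of the transform of \<open>h\<close>
  at \<open>p = n + 1\<close> says that \<open>H\<close> is orthogonal to \<open>u\<^sup>n\<close> for \<open>u = e\<^sup>-\<^sup>t \<in> [0, 1]\<close>. By the Weierstrass
  theorem \<open>H\<close> is orthogonal to every continuous function of \<open>u\<close>, by dominated convergence also to
  the indicator of \<open>u < e\<^sup>-\<^sup>x\<close>, that is, of \<open>t > x\<close>. So \<open>H\<close> integrates to zero over every ray,
  and the rays generate the Borel sets.
\<close>

section \<open>Functions with vanishing moments\<close>

text \<open>
  The positive and the negative part of \<open>H\<close> are densities of two finite measures that agree on a
  generator of the Borel sets closed under intersection. Hence the measures coincide, and so do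
  their densities up to a null set.
\<close>

lemma AE_eq_0_if_integral_rays_eq_0:
  fixes H :: "real \<Rightarrow> real"
  assumes int: "integrable lborel H"
    and rays: "\<And>x. (LINT t|lborel. indicator {x<..} t * H t) = 0"
  shows "AE t in lborel. H t = 0"
proof -
  note [measurable] = borel_measurable_integrable[OF int]
  have part: "emeasure (density lborel (\<lambda>t. ennreal (G t))) {x<..}
      = ennreal (LINT t|lborel. indicator {x<..} t * max 0 (G t))"
    if G: "integrable lborel G" for G :: "real \<Rightarrow> real" and x
  proof -
    note [measurable] = borel_measurable_integrable[OF G]
    have "integrable lborel (\<lambda>t. indicator {x<..} t * max 0 (G t))"
      by (rule Bochner_Integration.integrable_bound[OF G]) (auto simp: indicator_def)
    then have "(\<integral>\<^sup>+ t. ennreal (indicator {x<..} t * max 0 (G t)) \<partial>lborel)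
        = ennreal (LINT t|lborel. indicator {x<..} t * max 0 (G t))"
      by (intro nn_integral_eq_integral) auto
    moreover have "ennreal (G t) * indicator {x<..} t = ennreal (indicator {x<..} t * max 0 (G t))" for t
      by (auto simp: indicator_def max_def ennreal_neg)
    ultimately show ?thesis
      by (subst emeasure_density) simp_all
  qed
  have "density lborel (\<lambda>t. ennreal (H t)) = density lborel (\<lambda>t. ennreal (- H t))"
  proof (rule measure_eqI_lessThan)
    fix x
    have ints: "integrable lborel (\<lambda>t. indicator {x<..} t * max 0 (H t))"
      "integrable lborel (\<lambda>t. indicator {x<..} t * max 0 (- H t))"
      by (rule Bochner_Integration.integrable_bound[OF int]; auto simp: indicator_def)+
    have "0 = (LINT t|lborel. indicator {x<..} t * max 0 (H t) - indicator {x<..} t * max 0 (- H t))"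
      by (subst rays[of x, symmetric], rule Bochner_Integration.integral_cong)
         (auto simp: indicator_def max_def)
    also have "\<dots> = (LINT t|lborel. indicator {x<..} t * max 0 (H t))
        - (LINT t|lborel. indicator {x<..} t * max 0 (- H t))"
      by (rule Bochner_Integration.integral_diff[OF ints])
    finally show "emeasure (density lborel (\<lambda>t. ennreal (H t))) {x<..}
        = emeasure (density lborel (\<lambda>t. ennreal (- H t))) {x<..}"
      using int by (simp add: part)
  qed (use int in \<open>simp_all add: part\<close>)
  then have "AE t in lborel. ennreal (H t) = ennreal (- H t)"
    by (intro sigma_finite_measure.density_unique[OF sigma_finite_lborel]) auto
  then show ?thesis
  proof eventually_elim
    case (elim t)
    then show ?case
      by (cases "H t \<ge> 0") (auto simp: ennreal_neg)
  qed
qed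

text \<open>
  Weierstrass approximation. The error is controlled because a uniform error \<open>e\<close> on \<open>[0, 1]\<close>
  changes the integral by at most \<open>e\<close> times the \<open>L\<^sup>1\<close> norm of \<open>H\<close>.
\<close>

lemma integral_continuous_comp_eq_0_if_moments_eq_0:
  fixes H u :: "'a \<Rightarrow> real" and \<phi> :: "real \<Rightarrow> real"
  assumes int: "integrable M H"
    and u[measurable]: "u \<in> borel_measurable M" and u01: "\<And>t. u t \<in> {0..1}"
    and moments: "\<And>n. (LINT t|M. u t ^ n * H t) = 0"
    and \<phi>: "continuous_on UNIV \<phi>"
  shows "(LINT t|M. \<phi> (u t) * H t) = 0"
proof -
  note [measurable] = borel_measurable_integrable[OF int] borel_measurable_continuous_onI[OF \<phi>]
  have integrable_comp: "integrable M (\<lambda>t. \<psi> (u t) * H t)" if \<psi>: "continuous_on UNIV \<psi>" for \<psi> :: "real \<Rightarrow> real"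
  proof -
    note [measurable] = borel_measurable_continuous_onI[OF \<psi>]
    have "bounded (\<psi> ` {0..1})"
      by (intro compact_imp_bounded compact_continuous_image continuous_on_subset[OF \<psi>]) auto
    then obtain B where B: "\<And>v. v \<in> {0..1} \<Longrightarrow> \<bar>\<psi> v\<bar> \<le> B"
      unfolding bounded_iff by fastforce
    have "\<bar>\<psi> (u t) * H t\<bar> \<le> \<bar>B * H t\<bar>" for t
      using B[OF u01[of t]] by (auto simp: abs_mult intro!: mult_right_mono)
    then show ?thesis
      by (intro Bochner_Integration.integrable_bound[OF integrable_mult_right[OF int, of B]]) auto
  qed
  have le: "\<bar>LINT t|M. \<phi> (u t) * H t\<bar> \<le> e * (LINT t|M. \<bar>H t\<bar>)" if "e > 0" for e
  proof -
    obtain g where g: "real_polynomial_function g" and ge: "\<And>v. v \<in> {0..1} \<Longrightarrow> \<bar>\<phi> v - g v\<bar> < e"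
      using Stone_Weierstrass_real_polynomial_function[OF compact_Icc continuous_on_subset[OF \<phi>] \<open>e > 0\<close>]
      by (metis top_greatest)
    obtain a n where ga: "g = (\<lambda>v. \<Sum>i\<le>n. a i * v ^ i)"
      using g by (auto simp: real_polynomial_function_iff_sum)
    have cg: "continuous_on UNIV g"
      unfolding ga by (intro continuous_intros)
    have "(LINT t|M. g (u t) * H t) = (LINT t|M. (\<Sum>i\<le>n. a i * (u t ^ i * H t)))"
      by (simp add: ga sum_distrib_right mult.assoc)
    also have "\<dots> = (\<Sum>i\<le>n. LINT t|M. a i * (u t ^ i * H t))"
      by (intro Bochner_Integration.integral_sum integrable_mult_right integrable_comp continuous_intros)
    also have "\<dots> = 0"
      by (simp add: moments)
    finally have "(LINT t|M. \<phi> (u t) * H t) = (LINT t|M. \<phi> (u t) * H t - g (u t) * H t)"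
      by (subst Bochner_Integration.integral_diff) (auto intro!: integrable_comp \<phi> cg)
    also have "\<bar>\<dots>\<bar> \<le> (LINT t|M. e * \<bar>H t\<bar>)"
    proof (rule integral_abs_bound[THEN order_trans], rule integral_mono)
      show "\<bar>\<phi> (u t) * H t - g (u t) * H t\<bar> \<le> e * \<bar>H t\<bar>" for t
        using ge[OF u01[of t]]
        by (simp add: left_diff_distrib[symmetric] abs_mult mult_right_mono)
    qed (auto intro!: Bochner_Integration.integrable_diff integrable_comp \<phi> cg int integrable_abs)
    finally show ?thesis
      by simp
  qed
  have "\<bar>LINT t|M. \<phi> (u t) * H t\<bar> \<le> 0 + e" if "e > 0" for e
  proof -
    let ?N = "LINT t|M. \<bar>H t\<bar>"
    have N: "?N \<ge> 0" "?N + 1 > 0"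
      by (simp_all add: add_nonneg_pos)
    have "\<bar>LINT t|M. \<phi> (u t) * H t\<bar> \<le> e / (?N + 1) * ?N"
      using that N by (intro le divide_pos_pos) linarith+
    also have "\<dots> \<le> e"
      using that N by (simp add: pos_divide_le_eq distrib_left)
    finally show ?thesis by simp
  qed
  from field_le_epsilon[of "\<bar>LINT t|M. \<phi> (u t) * H t\<bar>" 0, OF this] show ?thesis
    by simp
qed

lemma integral_sublevel_eq_0_if_moments_eq_0:
  fixes H u :: "'a \<Rightarrow> real"
  assumes int: "integrable M H"
    and u[measurable]: "u \<in> borel_measurable M" and u01: "\<And>t. u t \<in> {0..1}"
    and moments: "\<And>n. (LINT t|M. u t ^ n * H t) = 0"
  shows "(LINT t|M. indicator {..<c} (u t) * H t) = 0"
proof -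
  note [measurable] = borel_measurable_integrable[OF int]
  \<comment> \<open>Continuous ramps increasing to the indicator of the open set \<open>{..<c}\<close>.\<close>
  define \<phi> :: "nat \<Rightarrow> real \<Rightarrow> real" where "\<phi> k v = min 1 (max 0 (real k * (c - v)))" for k v
  have cont: "continuous_on UNIV (\<phi> k)" for k
    unfolding \<phi>_def by (intro continuous_intros)
  note [measurable] = borel_measurable_continuous_onI[OF cont]
  have lim: "(\<lambda>k. \<phi> k v) \<longlonglongrightarrow> indicator {..<c} v" for v
  proof (cases "v < c")
    case True
    obtain K :: nat where K: "1 / (c - v) \<le> real K"
      using real_arch_simple by blast
    have "\<phi> k v = 1" if "k \<ge> K" for k
    proof -
      have "1 / (c - v) \<le> real k"
        using K that by linarith
      then have "1 \<le> real k * (c - v)"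
        using True by (simp add: field_simps)
      then show ?thesis by (simp add: \<phi>_def)
    qed
    then show ?thesis
      using True by (intro tendsto_eventually) (auto simp: eventually_sequentially)
  next
    case False
    then have "real k * (c - v) \<le> 0" for k
      by (simp add: mult_nonneg_nonpos)
    then have "\<phi> k v = 0" for k
      by (simp add: \<phi>_def max_absorb1)
    then show ?thesis
      using False by simp
  qed
  have "(\<lambda>k. LINT t|M. \<phi> k (u t) * H t) \<longlonglongrightarrow> (LINT t|M. indicator {..<c} (u t) * H t)"
  proof (rule integral_dominated_convergence[where w = "\<lambda>t. \<bar>H t\<bar>"])
    show "AE t in M. (\<lambda>k. \<phi> k (u t) * H t) \<longlonglongrightarrow> indicator {..<c} (u t) * H t"
      by (intro AE_I2 tendsto_mult lim tendsto_const)
    show "AE t in M. norm (\<phi> k (u t) * H t) \<le> \<bar>H t\<bar>" for k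
      by (intro AE_I2) (auto simp: \<phi>_def abs_mult intro!: mult_left_le_one_le)
  qed (use int in auto)
  moreover have "(LINT t|M. \<phi> k (u t) * H t) = 0" for k
    by (rule integral_continuous_comp_eq_0_if_moments_eq_0[OF int u u01 moments cont])
  ultimately show ?thesis
    by (simp add: LIMSEQ_const_iff)
qed

section \<open>Uniqueness of the Laplace original\<close>

lemma has_laplace_transform_iff_has_bochner_integral:
  "has_laplace_transform f F \<longleftrightarrow>
    (\<forall>p>0. has_bochner_integral lborel (\<lambda>t. indicator {0<..} t * (exp (- (p * t)) * f t)) (F p))"
  by (simp add: has_laplace_transform_def interval_lebesgue_integrable_def
      interval_lebesgue_integral_def set_integrable_def set_lebesgue_integral_def
      has_bochner_integral_iff zero_ereal_def)

lemma has_laplace_transform_borel_measurable: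
  assumes "has_laplace_transform f F"
  shows "(\<lambda>t. indicator {0<..} t * f t) \<in> borel_measurable borel"
proof -
  have "(\<lambda>t. indicator {0<..} t * (exp (- (1 * t)) * f t)) \<in> borel_measurable borel"
    using assms zero_less_one unfolding has_laplace_transform_iff_has_bochner_integral
      has_bochner_integral_iff by (metis borel_measurable_integrable measurable_lborel2)
  then have "(\<lambda>t. exp t * (indicator {0<..} t * (exp (- (1 * t)) * f t))) \<in> borel_measurable borel"
    by measurable
  also have "(\<lambda>t. exp t * (indicator {0<..} t * (exp (- (1 * t)) * f t))) = (\<lambda>t. indicator {0<..} t * f t)"
    by (auto simp: exp_minus)
  finally show ?thesis .
qed

text \<open>
  Lerch's theorem. Splitting \<open>e\<^sup>-\<^sup>(\<^sup>n\<^sup>+\<^sup>1\<^sup>)\<^sup>t\<close> as \<open>u\<^sup>n\<close> times \<open>e\<^sup>-\<^sup>t\<close> turns the transform at \<open>n + 1\<close> into the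
  \<open>n\<close>-th moment of \<open>H\<close>; the factor \<open>e\<^sup>-\<^sup>t\<close> is kept in \<open>H\<close> because the originals themselves need not be
  integrable.
\<close>

lemma laplace_transform_unique_AE:
  assumes f: "has_laplace_transform f F" and g: "has_laplace_transform g F"
  shows "AE t in lborel. 0 < t \<longrightarrow> f t = g t"
proof -
  have diff: "has_bochner_integral lborel
      (\<lambda>t. indicator {0<..} t * (exp (- (p * t)) * (f t - g t))) 0" if "p > 0" for p
    using has_bochner_integral_diff
      [OF f[unfolded has_laplace_transform_iff_has_bochner_integral, rule_format, OF that]
          g[unfolded has_laplace_transform_iff_has_bochner_integral, rule_format, OF that]]
    by (simp add: algebra_simps)
  define H where "H t = indicator {0<..} t * (exp (- t) * (f t - g t))" for t
  \<comment> \<open>The minimum only matters off the support of \<open>H\<close>, where it keeps \<open>u\<close> inside \<open>[0, 1]\<close>.\<close>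
  define u :: "real \<Rightarrow> real" where "u t = min 1 (exp (- t))" for t
  have int: "integrable lborel H"
    using diff[of 1] by (simp add: H_def[abs_def] has_bochner_integral_iff)
  have [measurable]: "u \<in> borel_measurable lborel"
    unfolding u_def by measurable
  have u01: "u t \<in> {0..1}" for t
    by (simp add: u_def)
  have moments: "(LINT t|lborel. u t ^ n * H t) = 0" for n
  proof -
    have "u t ^ n * H t = indicator {0<..} t * (exp (- (real (Suc n) * t)) * (f t - g t))" for t
    proof (cases "t > 0")
      case True
      then have "u t ^ n * exp (- t) = exp (- (real (Suc n) * t))"
        by (simp add: u_def min_def exp_of_nat_mult[symmetric] exp_add[symmetric] algebra_simps)
      then show ?thesis
        using True by (simp add: H_def mult.assoc[symmetric])
    qed (simp add: H_def)
    then show ?thesis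
      using diff[of "real (Suc n)"] by (simp add: has_bochner_integral_iff)
  qed
  have "(LINT t|lborel. indicator {x<..} t * H t) = 0" for x
  proof -
    have "indicator {x<..} t * H t = indicator {..<exp (- x)} (u t) * H t" for t
      by (cases "t > 0") (auto simp: H_def u_def indicator_def min_def)
    then show ?thesis
      by (simp only:) (rule integral_sublevel_eq_0_if_moments_eq_0[OF int _ u01 moments], measurable)
  qed
  then have "AE t in lborel. H t = 0"
    by (rule AE_eq_0_if_integral_rays_eq_0[OF int])
  then show ?thesis
    by eventually_elim (auto simp: H_def)
qed

section \<open>The kernel of the generator \<open>p\<close>\<close>

text \<open>
  Euler's integral for \<open>\<Gamma>(\<gamma>)\<close> under the substitution of \<open>p t\<close> for \<open>t\<close>.
\<close>

lemma has_laplace_transform_powr: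
  assumes "\<gamma> > 0"
  shows "has_laplace_transform (\<lambda>t. t powr (\<gamma> - 1) / Gamma \<gamma>) (\<lambda>p. p powr (- \<gamma>))"
  unfolding has_laplace_transform_iff_has_bochner_integral
proof (intro allI impI)
  fix p :: real assume p: "p > 0"
  have G: "Gamma \<gamma> > 0"
    using assms by (rule Gamma_real_pos)
  have "has_bochner_integral lborel (\<lambda>t. indicator {0..} t * t powr (\<gamma> - 1) / exp t) (Gamma \<gamma>)"
    using G by (intro has_bochner_integral_nn_integral)
      (auto simp: Gamma_conv_nn_integral_real[OF assms, symmetric])
  then have "has_bochner_integral lborel
      (\<lambda>t. indicator {0..} (0 + p * t) * (0 + p * t) powr (\<gamma> - 1) / exp (0 + p * t))
      (Gamma \<gamma> /\<^sub>R \<bar>p\<bar>)"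
    using p by (subst (asm) lborel_has_bochner_integral_real_affine_iff[of p _ _ 0]) auto
  from has_bochner_integral_mult_right[OF this, of "p powr (1 - \<gamma>) / Gamma \<gamma>"]
  have "has_bochner_integral lborel
      (\<lambda>t. p powr (1 - \<gamma>) / Gamma \<gamma> * (indicator {0..} (p * t) * (p * t) powr (\<gamma> - 1) / exp (p * t)))
      (p powr (1 - \<gamma>) / Gamma \<gamma> * (Gamma \<gamma> / p))"
    using p by (simp add: divide_inverse mult.commute)
  also have "p powr (1 - \<gamma>) / Gamma \<gamma> * (Gamma \<gamma> / p) = p powr (- \<gamma>)"
    using p G by (simp add: powr_diff powr_minus field_simps)
  also have "(\<lambda>t. p powr (1 - \<gamma>) / Gamma \<gamma> * (indicator {0..} (p * t) * (p * t) powr (\<gamma> - 1) / exp (p * t)))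
      = (\<lambda>t. indicator {0<..} t * (exp (- (p * t)) * (t powr (\<gamma> - 1) / Gamma \<gamma>)))"
  proof
    fix t :: real
    show "p powr (1 - \<gamma>) / Gamma \<gamma> * (indicator {0..} (p * t) * (p * t) powr (\<gamma> - 1) / exp (p * t))
      = indicator {0<..} t * (exp (- (p * t)) * (t powr (\<gamma> - 1) / Gamma \<gamma>))"
    proof (cases "t > 0")
      case True
      have "p powr (1 - \<gamma>) * p powr (\<gamma> - 1) = 1"
        using p by (simp add: powr_add[symmetric])
      then show ?thesis
        using True p G by (simp add: powr_mult exp_minus field_simps)
    next
      case False
      then show ?thesis
        using p by (cases "t = 0") (auto simp: indicator_def zero_le_mult_iff)
    qed
  qed
  finally show "has_bochner_integral lborel
      (\<lambda>t. indicator {0<..} t * (exp (- (p * t)) * (t powr (\<gamma> - 1) / Gamma \<gamma>))) (p powr (- \<gamma>))" .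
qed

lemma has_laplace_transform_dm_kernel:
  assumes "\<And>p. p > 0 \<Longrightarrow> \<Phi> p \<Theta> = p" and "\<gamma> > 0"
  shows "has_laplace_transform (dm_kernel \<Phi> \<Theta> \<gamma>) (\<lambda>p. p powr (- \<gamma>))"
proof -
  have cong: "has_laplace_transform f (\<lambda>p. \<Phi> p \<Theta> powr (- \<gamma>)) \<longleftrightarrow> has_laplace_transform f (\<lambda>p. p powr (- \<gamma>))" for f
    using assms(1) by (simp add: has_laplace_transform_def)
  show ?thesis
    unfolding dm_kernel_def inverse_laplace_def cong
    by (rule someI[where P = "\<lambda>f. has_laplace_transform f (\<lambda>p. p powr (- \<gamma>))"])
       (rule has_laplace_transform_powr[OF \<open>\<gamma> > 0\<close>])
qed

text \<open>
  The reflection \<open>s \<mapsto> t - s\<close> preserves null sets, so the kernel may be replaced by the power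
  function under the integral. Integrability of the classical integrand is what provides
  measurability of \<open>y\<close> on \<open>(0, t)\<close>, without which almost everywhere equal integrands need not have
  the same Bochner integral.
\<close>

lemma convolution_dm_kernel_power:
  fixes y :: "real \<Rightarrow> real"
  assumes generator: "\<And>p. p > 0 \<Longrightarrow> \<Phi> p \<Theta> = p" and \<gamma>: "\<gamma> > 0" and t: "0 \<le> t"
    and int: "interval_lebesgue_integrable lborel 0 t (\<lambda>s. (t - s) powr (\<gamma> - 1) * y s)"
  shows "(LBINT s=0..t. dm_kernel \<Phi> \<Theta> \<gamma> (t - s) * y s)
    = 1 / Gamma \<gamma> * (LBINT s=0..t. (t - s) powr (\<gamma> - 1) * y s)"
proof -
  define k where "k = dm_kernel \<Phi> \<Theta> \<gamma>"
  define w where "w s = indicator {0<..<t} s * ((t - s) powr (\<gamma> - 1) * y s)" for s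
  have k: "has_laplace_transform k (\<lambda>p. p powr (- \<gamma>))"
    unfolding k_def using generator \<gamma> by (rule has_laplace_transform_dm_kernel)
  have LBINT_eq: "(LBINT s=0..t. h s) = (LINT s|lborel. indicator {0<..<t} s * h s)" for h :: "real \<Rightarrow> real"
    using t by (simp add: zero_ereal_def interval_lebesgue_integral_def set_lebesgue_integral_def)
  have [measurable]: "w \<in> borel_measurable borel"
    using int t by (auto simp: w_def[abs_def] interval_lebesgue_integrable_def set_integrable_def zero_ereal_def
        dest: borel_measurable_integrable)
  define k0 where "k0 r = indicator {0<..} r * k r" for r
  have [measurable]: "k0 \<in> borel_measurable borel"
    unfolding k0_def using has_laplace_transform_borel_measurable[OF k] .
  \<comment> \<open>Measurability is known for \<open>w\<close> and \<open>k0\<close> only, so \<open>y\<close> is recovered from \<open>w\<close> by cancelling the power.\<close>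
  have integrand: "indicator {0<..<t} s * (k (t - s) * y s) = k0 (t - s) * (t - s) powr (1 - \<gamma>) * w s" for s
  proof (cases "s \<in> {0<..<t}")
    case True
    then have "(t - s) powr (1 - \<gamma>) * (t - s) powr (\<gamma> - 1) = 1"
      by (simp add: powr_add[symmetric])
    then show ?thesis
      using True by (simp add: w_def k0_def)
  qed (simp add: w_def)
  have "AE r in lborel. k0 r = indicator {0<..} r * (r powr (\<gamma> - 1) / Gamma \<gamma>)"
    using laplace_transform_unique_AE[OF k has_laplace_transform_powr[OF \<gamma>]]
    by eventually_elim (auto simp: k0_def indicator_def)
  then have "AE s in lborel. k0 (t + - 1 * s) = indicator {0<..} (t + - 1 * s) * ((t + - 1 * s) powr (\<gamma> - 1) / Gamma \<gamma>)"
    by (intro AE_borel_affine) simp_all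
  then have ae: "AE s in lborel. k0 (t - s) * (t - s) powr (1 - \<gamma>) * w s = 1 / Gamma \<gamma> * w s"
  proof eventually_elim
    case (elim s)
    show ?case
    proof (cases "s \<in> {0<..<t}")
      case True
      then have "(t - s) powr (\<gamma> - 1) * (t - s) powr (1 - \<gamma>) = 1"
        by (simp add: powr_add[symmetric])
      then show ?thesis
        using True elim by simp
    qed (simp add: w_def)
  qed
  have "(LBINT s=0..t. k (t - s) * y s) = (LINT s|lborel. k0 (t - s) * (t - s) powr (1 - \<gamma>) * w s)"
    by (simp add: LBINT_eq integrand)
  also have "\<dots> = (LINT s|lborel. 1 / Gamma \<gamma> * w s)"
    by (intro integral_cong_AE ae) measurable
  also have "\<dots> = 1 / Gamma \<gamma> * (LBINT s=0..t. (t - s) powr (\<gamma> - 1) * y s)"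
    by (simp add: LBINT_eq w_def)
  finally show ?thesis
    by (simp add: k_def)
qed

section \<open>Reduction to the classical operators\<close>

theorem theorem3p17:
  fixes \<Phi> :: "real \<Rightarrow> 'p \<Rightarrow> real" and \<Theta> :: 'p and T :: real and x :: "real \<Rightarrow> real"
  assumes generator: "\<And>p. p > 0 \<Longrightarrow> \<Phi> p \<Theta> = p"
    and "T > 0"
  shows
    "(\<forall>\<alpha>>0. \<forall>t\<in>{0..T}.
        interval_lebesgue_integrable lborel 0 t (\<lambda>s. (t - s) powr (\<alpha> - 1) * x s) \<longrightarrow>
        dm_integral \<Phi> \<Theta> \<alpha> x t =
          1 / Gamma \<alpha> * (LBINT s=0..t. (t - s) powr (\<alpha> - 1) * x s))
     \<and>
     (\<forall>\<alpha>. 0 < \<alpha> \<and> \<alpha> < 1 \<and>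
        (\<forall>\<tau>\<in>{0..T}.
           interval_lebesgue_integrable lborel 0 \<tau> (\<lambda>s. (\<tau> - s) powr (- \<alpha>) * x s)) \<longrightarrow>
        (\<forall>t\<in>{0..T}.
           (\<lambda>\<tau>. LBINT s=0..\<tau>. (\<tau> - s) powr (- \<alpha>) * x s) differentiable (at t within {0..T}) \<longrightarrow>
           dm_rl_derivative T \<Phi> \<Theta> \<alpha> x t =
             1 / Gamma (1 - \<alpha>) *
             vector_derivative (\<lambda>\<tau>. LBINT s=0..\<tau>. (\<tau> - s) powr (- \<alpha>) * x s)
               (at t within {0..T})))
     \<and>
     (x differentiable_on {0<..<T} \<longrightarrow>
       (\<forall>\<alpha>. 0 < \<alpha> \<and> \<alpha> < 1 \<longrightarrow>
        (\<forall>t\<in>{0..T}.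
           interval_lebesgue_integrable lborel 0 t (\<lambda>s. (t - s) powr (- \<alpha>) * deriv x s) \<longrightarrow>
           dm_caputo_derivative \<Phi> \<Theta> \<alpha> x t =
             1 / Gamma (1 - \<alpha>) * (LBINT s=0..t. (t - s) powr (- \<alpha>) * deriv x s))))"
proof (intro conjI allI ballI impI; (elim conjE)?)
  fix \<alpha> t :: real
  assume "0 < \<alpha>" "t \<in> {0..T}"
    and "interval_lebesgue_integrable lborel 0 t (\<lambda>s. (t - s) powr (\<alpha> - 1) * x s)"
  then show "dm_integral \<Phi> \<Theta> \<alpha> x t = 1 / Gamma \<alpha> * (LBINT s=0..t. (t - s) powr (\<alpha> - 1) * x s)"
    unfolding dm_integral_def using generator by (intro convolution_dm_kernel_power) auto
next
  fix \<alpha> t :: real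
  let ?G = "\<lambda>\<tau>::real. LBINT s=0..\<tau>. (\<tau> - s) powr (- \<alpha>) * x s"
  let ?K = "\<lambda>\<tau>::real. LBINT s=0..\<tau>. dm_kernel \<Phi> \<Theta> (1 - \<alpha>) (\<tau> - s) * x s"
  assume \<alpha>: "0 < \<alpha>" "\<alpha> < 1" and t: "t \<in> {0..T}"
    and int: "\<forall>\<tau>\<in>{0..T}. interval_lebesgue_integrable lborel 0 \<tau> (\<lambda>s. (\<tau> - s) powr (- \<alpha>) * x s)"
    and diff: "?G differentiable (at t within {0..T})"
  have eq: "?K \<tau> = 1 / Gamma (1 - \<alpha>) * ?G \<tau>" if "\<tau> \<in> {0..T}" for \<tau>
    using convolution_dm_kernel_power[of \<Phi> \<Theta> "1 - \<alpha>" \<tau> x] generator \<alpha> int that by simp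
  have "((\<lambda>\<tau>. 1 / Gamma (1 - \<alpha>) * ?G \<tau>) has_vector_derivative
      1 / Gamma (1 - \<alpha>) * vector_derivative ?G (at t within {0..T})) (at t within {0..T})"
    using diff by (intro has_vector_derivative_mult_right) (simp add: vector_derivative_works)
  then have "(?K has_vector_derivative
      1 / Gamma (1 - \<alpha>) * vector_derivative ?G (at t within {0..T})) (at t within {0..T})"
    by (rule has_vector_derivative_transform[OF t, rotated]) (rule eq)
  then show "dm_rl_derivative T \<Phi> \<Theta> \<alpha> x t
      = 1 / Gamma (1 - \<alpha>) * vector_derivative ?G (at t within {0..T})"
    unfolding dm_rl_derivative_def by (rule vector_derivative_within_closed_interval[OF \<open>T > 0\<close> t])
next
  fix \<alpha> t :: real
  assume "0 < \<alpha>" "\<alpha> < 1" "t \<in> {0..T}"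
    and "interval_lebesgue_integrable lborel 0 t (\<lambda>s. (t - s) powr (- \<alpha>) * deriv x s)"
  then show "dm_caputo_derivative \<Phi> \<Theta> \<alpha> x t
      = 1 / Gamma (1 - \<alpha>) * (LBINT s=0..t. (t - s) powr (- \<alpha>) * deriv x s)"
    unfolding dm_caputo_derivative_def
    using convolution_dm_kernel_power[of \<Phi> \<Theta> "1 - \<alpha>" t "deriv x"] generator by simp
qed

end
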